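(* Let $M,N\ge 1$ and $M_{\mathrm{cp}}\ge 0$ be integers, let $\Delta f>0$, and let $X^{\mathrm{DD}}[k,l]\in\mathbb{C}$ be given for integers $\lceil -N/2\rceil\le k\le\lceil N/2\rceil-1$ and $0\le l\le M-1$. Let $s(t)$ be the CP-OTFS transmit signal built from $X^{\mathrm{DD}}$ with rectangular pulses as defined in the context, and let $\rho_0\in\{0,\dots,M-1\}$ be the residue of $-M_{\mathrm{cp}}$ modulo $M$. Consider the condition $$X^{\mathrm{DD}}[k,0]=X^{\mathrm{DD}}[k,\rho_0]\,e^{j2\pi k/N}\quad\text{for all } \lceil -N/2\rceil\le k\le\lceil N/2\rceil-1. \qquad (\ast)$$ (i) If $(\ast)$ holds, then $s$ satisfies the boundary continuity condition $$\lim_{t\to (nT_{\mathrm{sym}})^-}s(t)=\lim_{t\to (nT_{\mathrm{sym}})^+}s(t)\quad\text{for every } 1\le n\le N-1.$$ (ii) If the continuity condition, in its delay-Doppler form $$\sum_{k=\lceil -N/2\rceil}^{\lceil N/2\rceil-1}X^{\mathrm{DD}}[k,0]\,e^{j2\pi (n-1)k/N}=\sum_{k=\lceil -N/2\rceil}^{\lceil N/2\rceil-1}X^{\mathrm{DD}}[k,\rho_0]\,e^{j2\pi nk/N},$$ is imposed for all $0\le n\le N-1$ (that is, with $n=0$ also included), then $(\ast)$ is necessary and sufficient for it: these $N$ identities all hold if and only if $(\ast)$ holds.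
   Context: Here $j=\sqrt{-1}$. Set $T=1/\Delta f$ (duration of an OFDM symbol without cyclic prefix), $T_{\mathrm{cp}}=M_{\mathrm{cp}}T/M$ (cyclic prefix duration), and $T_{\mathrm{sym}}=T+T_{\mathrm{cp}}$, so that $T=\frac{M T_{\mathrm{sym}}}{M+M_{\mathrm{cp}}}$. The time-frequency symbols are obtained by the inverse symplectic finite Fourier transform: for $0\le n\le N-1$ and $0\le m\le M-1$, $$X^{\mathrm{TF}}[n,m]=\frac{1}{\sqrt{NM}}\sum_{k=\lceil -N/2\rceil}^{\lceil N/2\rceil-1}\sum_{l=0}^{M-1}X^{\mathrm{DD}}[k,l]\,e^{-j2\pi\left(\frac{ml}{M}-\frac{nk}{N}\right)}.$$ The transmit pulse is rectangular: $g_{\mathrm{tx}}(t)=1/\sqrt{T}$ for $0\le t\le T_{\mathrm{sym}}$ and $g_{\mathrm{tx}}(t)=0$ otherwise. The transmit signal is $$s(t)=\sum_{m=0}^{M-1}\sum_{n=0}^{N-1}X^{\mathrm{TF}}[n,m]\,e^{j2\pi m\Delta f(t-T_{\mathrm{cp}}-nT_{\mathrm{sym}})}\,g_{\mathrm{tx}}(t-nT_{\mathrm{sym}}).$$ *)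

theory Defs
  imports "HOL-Analysis.Analysis"
begin

definition doppler_indices :: "nat \<Rightarrow> int set" where
  "doppler_indices N = {\<lceil>- (real N / 2)\<rceil> .. \<lceil>real N / 2\<rceil> - 1}"

definition T_ofdm :: "real \<Rightarrow> real" where
  "T_ofdm \<Delta>f = 1 / \<Delta>f"

definition T_cp :: "nat \<Rightarrow> nat \<Rightarrow> real \<Rightarrow> real" where
  "T_cp M Mcp \<Delta>f = real Mcp * T_ofdm \<Delta>f / real M"

definition T_sym :: "nat \<Rightarrow> nat \<Rightarrow> real \<Rightarrow> real" where
  "T_sym M Mcp \<Delta>f = T_ofdm \<Delta>f + T_cp M Mcp \<Delta>f"

text \<open>Inverse symplectic finite Fourier transform. Delay-Doppler data are total functions
  of (Doppler index k, delay index l); only values at k in \<^term>\<open>doppler_indices N\<close> and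
  l < M are ever used.\<close>

definition X_TF :: "nat \<Rightarrow> nat \<Rightarrow> (int \<Rightarrow> nat \<Rightarrow> complex) \<Rightarrow> nat \<Rightarrow> nat \<Rightarrow> complex" where
  "X_TF M N XDD n m =
     of_real (1 / sqrt (real N * real M)) *
     (\<Sum>k\<in>doppler_indices N. \<Sum>l<M.
        XDD k l * exp (- \<i> * of_real (2 * pi *
          (real m * real l / real M - real n * real_of_int k / real N))))"

definition g_tx :: "nat \<Rightarrow> nat \<Rightarrow> real \<Rightarrow> real \<Rightarrow> real" where
  "g_tx M Mcp \<Delta>f t =
     (if 0 \<le> t \<and> t \<le> T_sym M Mcp \<Delta>f then 1 / sqrt (T_ofdm \<Delta>f) else 0)"

definition tx_signal ::
    "nat \<Rightarrow> nat \<Rightarrow> nat \<Rightarrow> real \<Rightarrow> (int \<Rightarrow> nat \<Rightarrow> complex) \<Rightarrow> real \<Rightarrow> complex" where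
  "tx_signal M N Mcp \<Delta>f XDD t =
     (\<Sum>m<M. \<Sum>n<N.
        X_TF M N XDD n m *
        exp (\<i> * of_real (2 * pi * real m * \<Delta>f *
          (t - T_cp M Mcp \<Delta>f - real n * T_sym M Mcp \<Delta>f))) *
        of_real (g_tx M Mcp \<Delta>f (t - real n * T_sym M Mcp \<Delta>f)))"

definition rho0 :: "nat \<Rightarrow> nat \<Rightarrow> nat" where
  "rho0 M Mcp = nat ((- int Mcp) mod int M)"

definition dd_condition :: "nat \<Rightarrow> nat \<Rightarrow> nat \<Rightarrow> (int \<Rightarrow> nat \<Rightarrow> complex) \<Rightarrow> bool" where
  "dd_condition M N Mcp XDD \<longleftrightarrow>
     (\<forall>k\<in>doppler_indices N.
        XDD k 0 = XDD k (rho0 M Mcp) * exp (\<i> * of_real (2 * pi * real_of_int k / real N)))"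

text \<open>Both one-sided limits are required to exist, and to agree. The value of the signal at
  the boundary point itself is irrelevant; there, two consecutive pulses overlap because the
  support of \<^const>\<open>g_tx\<close> is closed.\<close>

definition boundary_continuous_at :: "(real \<Rightarrow> complex) \<Rightarrow> real \<Rightarrow> bool" where
  "boundary_continuous_at s a \<longleftrightarrow>
     (\<exists>L. (s \<longlongrightarrow> L) (at_left a) \<and> (s \<longlongrightarrow> L) (at_right a))"

text \<open>The index n is an integer so that n - 1 is not truncated at n = 0.\<close>

definition dd_continuity_identity ::
    "nat \<Rightarrow> nat \<Rightarrow> nat \<Rightarrow> (int \<Rightarrow> nat \<Rightarrow> complex) \<Rightarrow> int \<Rightarrow> bool" where
  "dd_continuity_identity M N Mcp XDD n \<longleftrightarrow>
     (\<Sum>k\<in>doppler_indices N.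
        XDD k 0 * exp (\<i> * of_real (2 * pi * real_of_int (n - 1) * real_of_int k / real N))) =
     (\<Sum>k\<in>doppler_indices N.
        XDD k (rho0 M Mcp) * exp (\<i> * of_real (2 * pi * real_of_int n * real_of_int k / real N)))"

end

theory Submission
  imports Defs
begin

text \<open>On the n-th block only the n-th pulse is non-zero, so the one-sided limits at a block boundary
  are carrier sums of two consecutive blocks. The cyclic prefix is a delay of \<open>M\<^sub>c\<^sub>p\<close> samples, and
  orthogonality of the carriers collapses the sum at the start of a block to the delay bin \<open>\<rho>\<^sub>0\<close>
  and the sum at its end to the delay bin 0. The continuity condition at the boundary thus compares
  two Doppler sums. Imposed for N consecutive indices n, it says that a discrete Fourier transform
  vanishes; the N Doppler indices are distinct modulo N, so every coefficient vanishes.\<close>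

section \<open>Finite Fourier analysis over the Doppler indices\<close>

lemma cis_two_pi_eq_1_iff: "cis (2 * pi * x) = 1 \<longleftrightarrow> x \<in> \<int>"
proof
  assume "cis (2 * pi * x) = 1"
  then have "cos (2 * pi * x) = 1"
    by (metis cis.sel(1) one_complex.sel(1))
  then obtain n :: int where "2 * pi * x = n * (2 * pi)"
    by (auto simp: cos_one_2pi_int)
  then show "x \<in> \<int>" by auto
qed (rule cis_multiple_2pi)

text \<open>A geometric sum whose ratio is an N-th root of unity, equal to 1 exactly when N divides
  \<open>a\<close>. Allowing negative \<open>a\<close> covers differences of Doppler indices and
  negated delays alike.\<close>

lemma sum_cis_orthogonality:
  fixes a :: int
  assumes "1 \<le> N"
  shows "(\<Sum>n<N. cis (2 * pi * real n * real_of_int a / real N)) =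
         (if int N dvd a then of_nat N else 0)"
proof -
  define z where "z = cis (2 * pi * (real_of_int a / real N))"
  have pow: "cis (2 * pi * real n * real_of_int a / real N) = z ^ n" for n
    unfolding z_def Complex.DeMoivre by (rule arg_cong[where f = cis]) simp
  have "z = 1 \<longleftrightarrow> real_of_int a / real N \<in> \<int>"
    unfolding z_def by (rule cis_two_pi_eq_1_iff)
  also have "\<dots> \<longleftrightarrow> int N dvd a"
    using assms of_int_div_of_int_in_Ints_iff[of a "int N", where ?'a = real] by simp
  finally have z1: "z = 1 \<longleftrightarrow> int N dvd a" .
  have "z ^ N = cis (2 * pi * real_of_int a)"
    unfolding pow[symmetric] by (rule arg_cong[where f = cis]) (use assms in simp)
  also have "\<dots> = 1"
    by (rule cis_multiple_2pi) simp
  finally have "z ^ N = 1" .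
  then show ?thesis
    using z1 by (auto simp: pow sum_gp_strict)
qed

text \<open>For either parity of N the range consists of N consecutive integers, so distinct Doppler
  indices are incongruent modulo N.\<close>

lemma abs_diff_doppler_indices_less:
  assumes "k \<in> doppler_indices N" "k' \<in> doppler_indices N"
  shows "\<bar>k - k'\<bar> < int N"
  using assms unfolding doppler_indices_def by (auto simp: abs_less_iff) linarith+

lemma finite_doppler_indices: "finite (doppler_indices N)"
  by (simp add: doppler_indices_def)

text \<open>Fourier inversion: multiplying by the conjugate character of \<open>k'\<close> and
  summing over \<open>n\<close> leaves N times the coefficient at \<open>k'\<close>.\<close>

lemma doppler_transform_eq_0_iff:
  fixes d :: "int \<Rightarrow> complex"
  assumes "1 \<le> N"
  shows "(\<forall>n<N. (\<Sum>k\<in>doppler_indices N. d k * cis (2 * pi * real n * real_of_int k / real N)) = 0)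
         \<longleftrightarrow> (\<forall>k\<in>doppler_indices N. d k = 0)"
proof (intro iffI ballI)
  fix k'
  assume zero: "\<forall>n<N. (\<Sum>k\<in>doppler_indices N. d k * cis (2 * pi * real n * real_of_int k / real N)) = 0"
    and k': "k' \<in> doppler_indices N"
  have "0 = (\<Sum>n<N. cis (- (2 * pi * real n * real_of_int k' / real N)) *
      (\<Sum>k\<in>doppler_indices N. d k * cis (2 * pi * real n * real_of_int k / real N)))"
    using zero by simp
  also have "\<dots> = (\<Sum>n<N. \<Sum>k\<in>doppler_indices N.
      d k * cis (2 * pi * real n * real_of_int (k - k') / real N))"
    by (intro sum.cong refl)
      (simp add: sum_distrib_left mult.left_commute[of "cis _" "d _"] cis_mult
        diff_divide_distrib right_diff_distrib)
  also have "\<dots> = (\<Sum>k\<in>doppler_indices N. d k *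
      (\<Sum>n<N. cis (2 * pi * real n * real_of_int (k - k') / real N)))"
    by (subst sum.swap) (simp only: sum_distrib_left)
  also have "\<dots> = (\<Sum>k\<in>doppler_indices N. if k = k' then d k * of_nat N else 0)"
  proof (intro sum.cong refl)
    fix k assume "k \<in> doppler_indices N"
    then have "int N dvd k - k' \<longleftrightarrow> k = k'"
      using abs_diff_doppler_indices_less[OF _ k', of k] dvd_imp_le_int[of "k - k'" "int N"] by auto
    then show "d k * (\<Sum>n<N. cis (2 * pi * real n * real_of_int (k - k') / real N)) =
        (if k = k' then d k * of_nat N else 0)"
      by (simp only: sum_cis_orthogonality[OF assms] if_distrib[of "(*) _"] mult_zero_right)
  qed
  also have "\<dots> = d k' * of_nat N"
    using k' by (simp add: finite_doppler_indices)
  finally show "d k' = 0" using assms by simp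
qed simp

section \<open>Carrier sums of the time-frequency symbols\<close>

text \<open>The extra phase acts as a delay by \<open>c\<close> samples, so summation over the
  carriers keeps only the bin \<open>l\<close> congruent to \<open>-c\<close> modulo M. The delay is
  left general because the start of a block needs \<open>c = Mcp\<close> and its end needs
  \<open>c = 0\<close>.\<close>

lemma sum_X_TF_modulated:
  fixes c :: nat
  assumes "1 \<le> M"
  shows "(\<Sum>m<M. X_TF M N XDD n m * cis (- (2 * pi * real m * real c / real M))) =
         of_real (1 / sqrt (real N * real M)) * of_nat M *
         (\<Sum>k\<in>doppler_indices N. XDD k (rho0 M c) * cis (2 * pi * real n * real_of_int k / real N))"
proof -
  define A where "A = complex_of_real (1 / sqrt (real N * real M))"
  define \<theta> where "\<theta> k = 2 * pi * real n * real_of_int k / real N" for k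
  \<comment> \<open>The ISFFT phase in \<open>l\<close> and the delay \<open>c\<close> merge into
    one character with integer frequency \<open>-(l + c)\<close>, the form required by
    \<open>sum_cis_orthogonality\<close>.\<close>
  define \<phi> where "\<phi> m l = 2 * pi * real m * real_of_int (- int (l + c)) / real M" for m l :: nat
  have X: "X_TF M N XDD n m * cis (- (2 * pi * real m * real c / real M)) =
      A * (\<Sum>k\<in>doppler_indices N. \<Sum>l<M. XDD k l * cis (\<theta> k) * cis (\<phi> m l))" for m
  proof -
    have "exp (- \<i> * of_real (2 * pi * (real m * real l / real M - real n * real_of_int k / real N)))
       * cis (- (2 * pi * real m * real c / real M)) = cis (\<theta> k) * cis (\<phi> m l)" for k l
      unfolding cis_conv_exp \<theta>_def \<phi>_def exp_add[symmetric]
      by (rule arg_cong[where f = exp])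
        (simp add: complex_eq_iff add_divide_distrib diff_divide_distrib algebra_simps)
    then show ?thesis
      unfolding X_TF_def A_def by (simp add: sum_distrib_right mult.assoc)
  qed
  have rho: "rho0 M c < M"
    using assms by (simp add: rho0_def nat_less_iff)
  have dvd: "int M dvd - int (l + c) \<longleftrightarrow> l = rho0 M c" if "l < M" for l
  proof -
    have "int M dvd - int (l + c) \<longleftrightarrow> int l mod int M = (- int c) mod int M"
      by (simp add: mod_eq_dvd_iff dvd_minus_iff flip: of_nat_add dvd_minus_iff[of _ "int l + int c"])
    also have "\<dots> \<longleftrightarrow> l = rho0 M c"
      using that assms by (auto simp: rho0_def)
    finally show ?thesis .
  qed
  have swap: "(\<Sum>m<M. \<Sum>k\<in>doppler_indices N. \<Sum>l<M. f m k l) =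
      (\<Sum>k\<in>doppler_indices N. \<Sum>l<M. \<Sum>m<M. f m k l)" for f :: "nat \<Rightarrow> int \<Rightarrow> nat \<Rightarrow> complex"
    by (rule trans[OF sum.swap]) (intro sum.cong refl sum.swap)
  have "(\<Sum>m<M. X_TF M N XDD n m * cis (- (2 * pi * real m * real c / real M))) =
      A * (\<Sum>k\<in>doppler_indices N. \<Sum>l<M. XDD k l * cis (\<theta> k) * (\<Sum>m<M. cis (\<phi> m l)))"
    unfolding X sum_distrib_left[symmetric]
    by (subst swap) (simp only: sum_distrib_left)
  also have "\<dots> = A * (\<Sum>k\<in>doppler_indices N. XDD k (rho0 M c) * cis (\<theta> k) * of_nat M)"
  proof -
    have "(\<Sum>l<M. XDD k l * cis (\<theta> k) * (\<Sum>m<M. cis (\<phi> m l))) =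
        XDD k (rho0 M c) * cis (\<theta> k) * of_nat M" for k
    proof -
      have "(\<Sum>l<M. XDD k l * cis (\<theta> k) * (\<Sum>m<M. cis (\<phi> m l))) =
          (\<Sum>l<M. if l = rho0 M c then XDD k l * cis (\<theta> k) * of_nat M else 0)"
        unfolding \<phi>_def sum_cis_orthogonality[OF assms]
        by (intro sum.cong refl) (use dvd in auto)
      then show ?thesis using rho by simp
    qed
    then show ?thesis by simp
  qed
  finally show ?thesis
    by (simp add: A_def \<theta>_def sum_distrib_left mult_ac)
qed

section \<open>One-sided limits of the transmit signal at block boundaries\<close>

lemma T_sym_pos: "0 < \<Delta>f \<Longrightarrow> 0 < T_sym M Mcp \<Delta>f"
  by (simp add: T_sym_def T_ofdm_def T_cp_def add_pos_nonneg)

text \<open>The pulse is replaced by its constant height for all times, which makes the function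
  continuous and lets it be evaluated at both ends of its block.\<close>

definition block_signal ::
    "nat \<Rightarrow> nat \<Rightarrow> nat \<Rightarrow> real \<Rightarrow> (int \<Rightarrow> nat \<Rightarrow> complex) \<Rightarrow> nat \<Rightarrow> real \<Rightarrow> complex" where
  "block_signal M N Mcp \<Delta>f XDD n t =
     (\<Sum>m<M. X_TF M N XDD n m *
        cis (2 * pi * real m * \<Delta>f * (t - T_cp M Mcp \<Delta>f - real n * T_sym M Mcp \<Delta>f)) *
        of_real (1 / sqrt (T_ofdm \<Delta>f)))"

text \<open>The time bounds are strict because the supports of neighbouring pulses, being closed,
  share the block endpoints.\<close>

lemma tx_signal_eq_block_signal:
  assumes "0 < \<Delta>f" "n < N"
    and t: "real n * T_sym M Mcp \<Delta>f < t" "t < (real n + 1) * T_sym M Mcp \<Delta>f"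
  shows "tx_signal M N Mcp \<Delta>f XDD t = block_signal M N Mcp \<Delta>f XDD n t"
proof -
  define S where "S = T_sym M Mcp \<Delta>f"
  have S: "0 < S" using T_sym_pos assms(1) by (simp add: S_def)
  have g: "g_tx M Mcp \<Delta>f (t - real i * S) = (if i = n then 1 / sqrt (T_ofdm \<Delta>f) else 0)" for i
  proof -
    have "i = n" if "real i * S \<le> t" "t \<le> (real i + 1) * S"
    proof -
      \<comment> \<open>Dividing by \<open>S\<close> gives \<open>i < n + 1\<close> and
        \<open>n < i + 1\<close>, which forces equality of the naturals.\<close>
      have "real i * S < (real n + 1) * S" "real n * S < (real i + 1) * S"
        using that t by (auto simp: S_def)
      then show ?thesis using S by simp
    qed
    then have "real i * S \<le> t \<and> t \<le> (real i + 1) * S \<longleftrightarrow> i = n"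
      using t unfolding S_def[symmetric] by (meson less_imp_le)
    moreover have "t - real i * S \<le> S \<longleftrightarrow> t \<le> (real i + 1) * S"
      unfolding distrib_right by linarith
    ultimately have "0 \<le> t - real i * S \<and> t - real i * S \<le> S \<longleftrightarrow> i = n"
      by simp
    then show ?thesis
      unfolding g_tx_def S_def[symmetric] by (rule if_cong) (rule refl)+
  qed
  show ?thesis
    unfolding tx_signal_def block_signal_def S_def[symmetric] g
  proof (intro sum.cong refl)
    fix m
    define c where "c i = X_TF M N XDD i m *
      exp (\<i> * of_real (2 * pi * real m * \<Delta>f * (t - T_cp M Mcp \<Delta>f - real i * S)))" for i
    have "(\<Sum>i<N. c i * of_real (if i = n then 1 / sqrt (T_ofdm \<Delta>f) else 0)) =
        (\<Sum>i<N. if i = n then c i * of_real (1 / sqrt (T_ofdm \<Delta>f)) else 0)"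
      by (intro sum.cong) auto
    also have "\<dots> = c n * of_real (1 / sqrt (T_ofdm \<Delta>f))"
      using assms(2) by simp
    finally show "(\<Sum>i<N. X_TF M N XDD i m *
        exp (\<i> * of_real (2 * pi * real m * \<Delta>f * (t - T_cp M Mcp \<Delta>f - real i * S))) *
        of_real (if i = n then 1 / sqrt (T_ofdm \<Delta>f) else 0)) =
      X_TF M N XDD n m * cis (2 * pi * real m * \<Delta>f * (t - T_cp M Mcp \<Delta>f - real n * S)) *
        of_real (1 / sqrt (T_ofdm \<Delta>f))"
      unfolding c_def cis_conv_exp .
  qed
qed

lemma isCont_block_signal: "isCont (block_signal M N Mcp \<Delta>f XDD n) t"
proof -
  have "continuous_on UNIV (block_signal M N Mcp \<Delta>f XDD n)"
    unfolding block_signal_def by (intro continuous_intros)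
  then show ?thesis by (simp add: continuous_on_eq_continuous_at)
qed

text \<open>A one-sided limit sees only the open block, where the signal agrees with the continuous
  \<open>block_signal\<close>.\<close>

lemma tx_signal_tendsto_at_right:
  assumes "0 < \<Delta>f" "n < N"
  shows "(tx_signal M N Mcp \<Delta>f XDD \<longlongrightarrow> block_signal M N Mcp \<Delta>f XDD n (real n * T_sym M Mcp \<Delta>f))
           (at_right (real n * T_sym M Mcp \<Delta>f))"
proof (rule Lim_transform_eventually)
  show "(block_signal M N Mcp \<Delta>f XDD n \<longlongrightarrow> block_signal M N Mcp \<Delta>f XDD n (real n * T_sym M Mcp \<Delta>f))
           (at_right (real n * T_sym M Mcp \<Delta>f))"
    using isCont_block_signal by (metis continuous_at_imp_continuous_at_within continuous_within)
  have "real n * T_sym M Mcp \<Delta>f < (real n + 1) * T_sym M Mcp \<Delta>f"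
    using T_sym_pos[OF assms(1)] by simp
  then show "\<forall>\<^sub>F t in at_right (real n * T_sym M Mcp \<Delta>f).
      block_signal M N Mcp \<Delta>f XDD n t = tx_signal M N Mcp \<Delta>f XDD t"
    using tx_signal_eq_block_signal[OF assms] by (subst eventually_at_right) auto
qed

lemma tx_signal_tendsto_at_left:
  assumes "0 < \<Delta>f" "n < N"
  shows "(tx_signal M N Mcp \<Delta>f XDD \<longlongrightarrow> block_signal M N Mcp \<Delta>f XDD n ((real n + 1) * T_sym M Mcp \<Delta>f))
           (at_left ((real n + 1) * T_sym M Mcp \<Delta>f))"
proof (rule Lim_transform_eventually)
  show "(block_signal M N Mcp \<Delta>f XDD n \<longlongrightarrow> block_signal M N Mcp \<Delta>f XDD n ((real n + 1) * T_sym M Mcp \<Delta>f))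
           (at_left ((real n + 1) * T_sym M Mcp \<Delta>f))"
    using isCont_block_signal by (metis continuous_at_imp_continuous_at_within continuous_within)
  have "real n * T_sym M Mcp \<Delta>f < (real n + 1) * T_sym M Mcp \<Delta>f"
    using T_sym_pos[OF assms(1)] by simp
  then show "\<forall>\<^sub>F t in at_left ((real n + 1) * T_sym M Mcp \<Delta>f).
      block_signal M N Mcp \<Delta>f XDD n t = tx_signal M N Mcp \<Delta>f XDD t"
    using tx_signal_eq_block_signal[OF assms] by (subst eventually_at_left) auto
qed

section \<open>Boundary values as Doppler sums\<close>

text \<open>At the start of a block the carrier time is \<open>- T_cp\<close>, and
  \<open>\<Delta>f\<close> times \<open>T_cp\<close> equals \<open>Mcp / M\<close>: a delay by
  \<open>Mcp\<close> samples.\<close>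

lemma block_signal_start:
  assumes "1 \<le> M" "0 < \<Delta>f"
  shows "block_signal M N Mcp \<Delta>f XDD n (real n * T_sym M Mcp \<Delta>f) =
    of_real (1 / sqrt (real N * real M)) * of_nat M *
    (\<Sum>k\<in>doppler_indices N. XDD k (rho0 M Mcp) * cis (2 * pi * real n * real_of_int k / real N)) *
    of_real (1 / sqrt (T_ofdm \<Delta>f))"
proof -
  have "2 * pi * real m * \<Delta>f *
      (real n * T_sym M Mcp \<Delta>f - T_cp M Mcp \<Delta>f - real n * T_sym M Mcp \<Delta>f) =
      - (2 * pi * real m * real Mcp / real M)" for m
    using assms by (simp add: T_cp_def T_ofdm_def)
  then show ?thesis
    unfolding block_signal_def sum_distrib_right[symmetric]
    by (simp only: sum_X_TF_modulated[OF assms(1)])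
qed

text \<open>At the end of a block the carriers have run through \<open>m \<Delta>f T = m\<close> full periods.\<close>

lemma block_signal_end:
  assumes "1 \<le> M" "0 < \<Delta>f"
  shows "block_signal M N Mcp \<Delta>f XDD n ((real n + 1) * T_sym M Mcp \<Delta>f) =
    of_real (1 / sqrt (real N * real M)) * of_nat M *
    (\<Sum>k\<in>doppler_indices N. XDD k 0 * cis (2 * pi * real n * real_of_int k / real N)) *
    of_real (1 / sqrt (T_ofdm \<Delta>f))"
proof -
  have "2 * pi * real m * \<Delta>f *
      ((real n + 1) * T_sym M Mcp \<Delta>f - T_cp M Mcp \<Delta>f - real n * T_sym M Mcp \<Delta>f) =
      2 * pi * real m" for m
    using assms by (simp add: T_sym_def T_ofdm_def algebra_simps)
  \<comment> \<open>The trivial phase is written as a delay by 0 samples, so that the same carrier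
    sum applies and selects the bin \<open>rho0 M 0 = 0\<close>.\<close>
  then have "block_signal M N Mcp \<Delta>f XDD n ((real n + 1) * T_sym M Mcp \<Delta>f) =
      (\<Sum>m<M. X_TF M N XDD n m * cis (- (2 * pi * real m * real 0 / real M))) *
      of_real (1 / sqrt (T_ofdm \<Delta>f))"
    unfolding block_signal_def sum_distrib_right[symmetric] by (simp only:) simp
  moreover have "rho0 M 0 = 0" by (simp add: rho0_def)
  ultimately show ?thesis
    by (simp only: sum_X_TF_modulated[OF assms(1)])
qed

section \<open>Continuity identities and the condition on the delay-Doppler data\<close>

text \<open>The shift from \<open>n\<close> to \<open>n - 1\<close> contributes a factor independent
  of \<open>n\<close>; absorbed into the coefficients, it turns the identity into the vanishing of a
  single Fourier sum.\<close>

lemma dd_continuity_identity_conv_transform: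
  "dd_continuity_identity M N Mcp XDD n \<longleftrightarrow>
     (\<Sum>k\<in>doppler_indices N.
        (XDD k 0 * cis (- (2 * pi * real_of_int k / real N)) - XDD k (rho0 M Mcp)) *
        cis (2 * pi * real_of_int n * real_of_int k / real N)) = 0"
proof -
  have "cis (2 * pi * real_of_int (n - 1) * real_of_int k / real N) =
      cis (- (2 * pi * real_of_int k / real N)) * cis (2 * pi * real_of_int n * real_of_int k / real N)" for k
    by (simp add: cis_mult diff_divide_distrib algebra_simps)
  then show ?thesis
    unfolding dd_continuity_identity_def cis_conv_exp[symmetric]
    by (simp add: left_diff_distrib sum_subtractf mult.assoc)
qed

text \<open>Multiplying the condition by the inverse phase yields exactly the Fourier coefficients
  of \<open>dd_continuity_identity_conv_transform\<close>.\<close>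

lemma dd_condition_conv_difference:
  "dd_condition M N Mcp XDD \<longleftrightarrow>
     (\<forall>k\<in>doppler_indices N.
        XDD k 0 * cis (- (2 * pi * real_of_int k / real N)) - XDD k (rho0 M Mcp) = 0)"
proof -
  have "x = y * cis a \<longleftrightarrow> x * cis (- a) - y = 0" for x y a
  proof -
    have "cis a * cis (- a) = 1" by (simp add: cis_mult)
    then show ?thesis by (auto simp: mult.assoc mult.commute)
  qed
  then show ?thesis
    unfolding dd_condition_def cis_conv_exp[symmetric] by simp
qed

lemma dd_condition_imp_dd_continuity_identity:
  "dd_condition M N Mcp XDD \<Longrightarrow> dd_continuity_identity M N Mcp XDD n"
  unfolding dd_condition_conv_difference dd_continuity_identity_conv_transform by simp

theorem mainTheorem1:
  fixes M N Mcp :: nat and \<Delta>f :: real and XDD :: "int \<Rightarrow> nat \<Rightarrow> complex"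
  assumes "1 \<le> M" and "1 \<le> N" and "0 < \<Delta>f"
  shows "(dd_condition M N Mcp XDD \<longrightarrow>
            (\<forall>n\<in>{1..N - 1}.
               boundary_continuous_at (tx_signal M N Mcp \<Delta>f XDD) (real n * T_sym M Mcp \<Delta>f)))
         \<and> ((\<forall>n\<in>{0..int N - 1}. dd_continuity_identity M N Mcp XDD n) \<longleftrightarrow>
              dd_condition M N Mcp XDD)"
proof (intro conjI impI ballI)
  fix n
  assume dd: "dd_condition M N Mcp XDD" and n: "n \<in> {1..N - 1}"
  \<comment> \<open>The block \<open>p\<close> ends at the boundary where block \<open>n\<close>
    starts; its index is the \<open>n - 1\<close> on the left of the continuity identity.\<close>
  then obtain p where p: "n = Suc p" "p < N" "n < N"
    by (cases n) auto
  have "block_signal M N Mcp \<Delta>f XDD p (real n * T_sym M Mcp \<Delta>f) =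
      block_signal M N Mcp \<Delta>f XDD n (real n * T_sym M Mcp \<Delta>f)"
    using dd_condition_imp_dd_continuity_identity[OF dd, of "int n"]
      block_signal_end[OF assms(1,3), of N Mcp XDD p]
    unfolding block_signal_start[OF assms(1,3)]
    by (simp add: p(1) dd_continuity_identity_def cis_conv_exp add.commute)
  then show "boundary_continuous_at (tx_signal M N Mcp \<Delta>f XDD) (real n * T_sym M Mcp \<Delta>f)"
    unfolding boundary_continuous_at_def
    using tx_signal_tendsto_at_left[OF assms(3) p(2), of M Mcp XDD]
      tx_signal_tendsto_at_right[OF assms(3) p(3), of M Mcp XDD]
    by (auto simp: p(1) add.commute)
next
  \<comment> \<open>Including \<open>n = 0\<close> gives N equations for the N Doppler coefficients;
    they are reindexed by naturals to match \<open>doppler_transform_eq_0_iff\<close>.\<close>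
  have "{0..int N - 1} = int ` {..<N}"
    by (auto simp: image_iff intro!: bexI[of _ "nat _"])
  then have "(\<forall>n\<in>{0..int N - 1}. dd_continuity_identity M N Mcp XDD n) \<longleftrightarrow>
      (\<forall>n<N. dd_continuity_identity M N Mcp XDD (int n))"
    by auto
  then show "(\<forall>n\<in>{0..int N - 1}. dd_continuity_identity M N Mcp XDD n) \<longleftrightarrow>
      dd_condition M N Mcp XDD"
    unfolding dd_continuity_identity_conv_transform dd_condition_conv_difference
    using doppler_transform_eq_0_iff[OF assms(2)] by simp
qed

end
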